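(* (1) Let $(\gamma,\nu_1,\nu_2):I\to\mathbb{R}^3\times\Delta$ and $(\tilde\gamma,\tilde\nu_1,\tilde\nu_2):J\to\mathbb{R}^3\times\Delta$ be framed curves. Then their frame matrix $T:I\times J\to SO(3)$ satisfies $T_{uv}=T_v\,{}^tT\,T_u$. (2) Suppose that $T:I\times J\to SO(3)$ is a smooth mapping with $T_{uv}=T_v\,{}^tT\,T_u$, and that $\alpha:I\to\mathbb{R}$ and $\tilde\alpha:J\to\mathbb{R}$ are smooth functions. Then there exist framed curves $(\gamma,\nu_1,\nu_2):I\to\mathbb{R}^3\times\Delta$ and $(\tilde\gamma,\tilde\nu_1,\tilde\nu_2):J\to\mathbb{R}^3\times\Delta$ such that $\gamma_u(u)=\alpha(u)\mu(u)$ and $\tilde\gamma_v(v)=\tilde\alpha(v)\tilde\mu(v)$, where $\mu=\nu_1\times\nu_2$ and $\tilde\mu=\tilde\nu_1\times\tilde\nu_2$, and such that the frame matrix of the framed curves $(\gamma,\nu_1,\nu_2)$ and $(\tilde\gamma,\tilde\nu_1,\tilde\nu_2)$ is $T$.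
   Context: All maps are $C^\infty$. $I,J\subset\mathbb{R}$ are intervals, with parameters $u\in I$, $v\in J$; subscripts $u,v$ denote partial derivatives; ${}^tA$ is the transpose of a matrix $A$. $S^2$ is the unit sphere in $\mathbb{R}^3$ and $\Delta=\{(a,b)\in S^2\times S^2 : a\cdot b=0\}$. A framed curve is a smooth map $(\gamma,\nu_1,\nu_2):I\to\mathbb{R}^3\times\Delta$ with $\gamma_u\cdot\nu_1=0$ and $\gamma_u\cdot\nu_2=0$ for all $u\in I$. Put $\mu=\nu_1\times\nu_2$. For framed curves $(\gamma,\nu_1,\nu_2)$ on $I$ and $(\tilde\gamma,\tilde\nu_1,\tilde\nu_2)$ on $J$, with $\mu=\nu_1\times\nu_2$ and $\tilde\mu=\tilde\nu_1\times\tilde\nu_2$, the frame matrix is the smooth map $T=(t_{ij}):I\times J\to SO(3)$ determined by $$\begin{pmatrix}\tilde\nu_1(v)\\ \tilde\nu_2(v)\\ \tilde\mu(v)\end{pmatrix}=T(u,v)\begin{pmatrix}\nu_1(u)\\ \nu_2(u)\\ \mu(u)\end{pmatrix},$$ i.e. $t_{ij}(u,v)$ is the inner product of the $i$-th vector of $(\tilde\nu_1,\tilde\nu_2,\tilde\mu)(v)$ with the $j$-th vector of $(\nu_1,\nu_2,\mu)(u)$. *)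

theory Defs
  imports "HOL-Analysis.Analysis"
begin

text \<open>
  Intervals may contain endpoints, so every derivative is taken within the domain. The derivative
  \<open>f'\<close> below is unique on the domains used here: nondegenerate intervals and products of two of them.
\<close>

primrec Ck_on :: "nat \<Rightarrow> 'a::real_normed_vector set \<Rightarrow> ('a \<Rightarrow> 'b::real_normed_vector) \<Rightarrow> bool" where
  "Ck_on 0 S f \<longleftrightarrow> continuous_on S f"
| "Ck_on (Suc k) S f \<longleftrightarrow>
     (\<exists>f'. (\<forall>x\<in>S. (f has_derivative f' x) (at x within S)) \<and> (\<forall>h. Ck_on k S (\<lambda>x. f' x h)))"

definition smooth_on :: "'a::real_normed_vector set \<Rightarrow> ('a \<Rightarrow> 'b::real_normed_vector) \<Rightarrow> bool" where
  "smooth_on S f \<longleftrightarrow> (\<forall>k. Ck_on k S f)"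

definition nondegenerate_interval :: "real set \<Rightarrow> bool" where
  "nondegenerate_interval I \<longleftrightarrow> is_interval I \<and> interior I \<noteq> {}"

definition Delta :: "((real^3) \<times> (real^3)) set" where
  "Delta = {(a, b). a \<in> sphere 0 1 \<and> b \<in> sphere 0 1 \<and> a \<bullet> b = 0}"

definition framed_curve ::
  "real set \<Rightarrow> (real \<Rightarrow> real^3) \<Rightarrow> (real \<Rightarrow> real^3) \<Rightarrow> (real \<Rightarrow> real^3) \<Rightarrow> bool" where
  "framed_curve I \<gamma> \<nu>1 \<nu>2 \<longleftrightarrow>
     smooth_on I (\<lambda>u. (\<gamma> u, \<nu>1 u, \<nu>2 u)) \<and>
     (\<forall>u\<in>I. (\<nu>1 u, \<nu>2 u) \<in> Delta \<and>
            vector_derivative \<gamma> (at u within I) \<bullet> \<nu>1 u = 0 \<and>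
            vector_derivative \<gamma> (at u within I) \<bullet> \<nu>2 u = 0)"

text \<open>The matrix whose rows are \<open>a\<close>, \<open>b\<close> and their cross product.\<close>

definition frame :: "real^3 \<Rightarrow> real^3 \<Rightarrow> real^3^3" where
  "frame a b = vector [a, b, cross3 a b]"

definition frame_matrix ::
  "(real \<Rightarrow> real^3) \<Rightarrow> (real \<Rightarrow> real^3) \<Rightarrow> (real \<Rightarrow> real^3) \<Rightarrow> (real \<Rightarrow> real^3) \<Rightarrow>
   real \<Rightarrow> real \<Rightarrow> real^3^3" where
  "frame_matrix \<nu>1 \<nu>2 \<nu>1' \<nu>2' u v =
     (\<chi> i j. (frame (\<nu>1' v) (\<nu>2' v) $ i) \<bullet> (frame (\<nu>1 u) (\<nu>2 u) $ j))"

definition partial_u :: "real set \<Rightarrow> (real \<Rightarrow> real \<Rightarrow> 'a::real_normed_vector) \<Rightarrow> real \<Rightarrow> real \<Rightarrow> 'a" where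
  "partial_u I T u v = vector_derivative (\<lambda>s. T s v) (at u within I)"

definition partial_v :: "real set \<Rightarrow> (real \<Rightarrow> real \<Rightarrow> 'a::real_normed_vector) \<Rightarrow> real \<Rightarrow> real \<Rightarrow> 'a" where
  "partial_v J T u v = vector_derivative (\<lambda>t. T u t) (at v within J)"

lemma orthogonal_matrix_frame:
  assumes "(a, b) \<in> Delta"
  shows "orthogonal_matrix (frame a b)"
proof -
  have n: "a \<bullet> a = 1" "b \<bullet> b = 1" "a \<bullet> b = 0"
    using assms by (auto simp: Delta_def norm_eq_1)
  have "cross3 a b \<bullet> cross3 a b = 1"
    using norm_cross_dot[of a b] assms
    by (simp add: Delta_def flip: power2_norm_eq_inner)
  moreover have "(frame a b ** transpose (frame a b)) $ i $ j = (frame a b $ i) \<bullet> (frame a b $ j)" for i j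
    by (simp add: matrix_matrix_mult_def transpose_def inner_vec_def)
  ultimately have "frame a b ** transpose (frame a b) = mat 1"
    using n by (simp add: vec_eq_iff forall_3 frame_def mat_def vector_3 dot_cross_self inner_commute)
  then show ?thesis
    by (simp add: orthogonal_matrix_def matrix_left_right_inverse)
qed

text \<open>The frame matrix is the unique matrix carrying the first frame to the second.\<close>

lemma frame_matrix_unique:
  assumes "(\<nu>1 u, \<nu>2 u) \<in> Delta"
  shows "frame (\<nu>1' v) (\<nu>2' v) = M ** frame (\<nu>1 u) (\<nu>2 u) \<longleftrightarrow>
         M = frame_matrix \<nu>1 \<nu>2 \<nu>1' \<nu>2' u v"
proof -
  let ?F = "frame (\<nu>1 u) (\<nu>2 u)" and ?G = "frame (\<nu>1' v) (\<nu>2' v)"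
  have "frame_matrix \<nu>1 \<nu>2 \<nu>1' \<nu>2' u v = ?G ** transpose ?F"
    by (simp add: frame_matrix_def matrix_matrix_mult_def transpose_def inner_vec_def)
  moreover have "transpose ?F ** ?F = mat 1" "?F ** transpose ?F = mat 1"
    using orthogonal_matrix_frame[OF assms] by (auto simp: orthogonal_matrix_def)
  ultimately show ?thesis
    by (metis matrix_mul_assoc matrix_mul_rid)
qed

end

theory Submission
  imports Defs
begin

text \<open>
  If the frames form the matrices \<open>F(u)\<close> and \<open>G(v)\<close>, then \<open>T = G F\<^sup>t\<close>, and the equation
  follows from \<open>F\<^sup>t F = G\<^sup>t G = 1\<close>. Conversely, the equation says exactly that \<open>T\<^sup>t T\<^sub>u\<close> does not
  depend on \<open>v\<close>; since it is skew-symmetric, \<open>T(u,v) T(u,v\<^sub>0)\<^sup>t\<close> does not depend on \<open>u\<close>. Hence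
  \<open>T(u,v) = G(v) F(u)\<^sup>t\<close> with \<open>F(u) = T(u,v\<^sub>0)\<^sup>t\<close> and \<open>G(v) = T(u\<^sub>0,v) T(u\<^sub>0,v\<^sub>0)\<^sup>t\<close>, so the rows of \<open>F\<close>
  and \<open>G\<close> are the required frames, and the curves are antiderivatives of \<open>\<alpha> \<mu>\<close> and \<open>\<alpha>' \<mu>'\<close>.
\<close>

section \<open>Smooth maps\<close>

text \<open>A differentiable map is continuous, and above that the same derivative serves as witness
  one level lower. The product rule relies on this.\<close>

lemma Ck_on_Suc_imp: "Ck_on (Suc k) S f \<Longrightarrow> Ck_on k S f"
proof (induction k arbitrary: f)
  case 0
  then show ?case
    by (auto intro: has_derivative_continuous_on)
next
  case (Suc k)
  then show ?case
    by (metis Ck_on.simps(2))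
qed

lemma Ck_on_const: "Ck_on k S (\<lambda>x. c)"
proof (induction k arbitrary: c)
  case (Suc k)
  then show ?case
    by (auto intro!: exI[of _ "\<lambda>_ _. 0"])
qed simp

lemma Ck_on_add: "Ck_on k S f \<Longrightarrow> Ck_on k S g \<Longrightarrow> Ck_on k S (\<lambda>x. f x + g x)"
proof (induction k arbitrary: f g)
  case 0
  then show ?case
    by (auto intro: continuous_on_add)
next
  case (Suc k)
  then obtain f' g' where
    "\<forall>x\<in>S. (f has_derivative f' x) (at x within S)" "\<forall>h. Ck_on k S (\<lambda>x. f' x h)"
    "\<forall>x\<in>S. (g has_derivative g' x) (at x within S)" "\<forall>h. Ck_on k S (\<lambda>x. g' x h)"
    by auto
  then show ?case
    using Suc.IH by (auto intro!: exI[of _ "\<lambda>x h. f' x h + g' x h"] has_derivative_add)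
qed

lemma Ck_on_linear:
  assumes L: "bounded_linear L"
  shows "Ck_on k S f \<Longrightarrow> Ck_on k S (\<lambda>x. L (f x))"
proof (induction k arbitrary: f)
  case 0
  then show ?case
    using bounded_linear.continuous_on[OF L] by auto
next
  case (Suc k)
  then obtain f' where
    "\<forall>x\<in>S. (f has_derivative f' x) (at x within S)" "\<forall>h. Ck_on k S (\<lambda>x. f' x h)"
    by auto
  then show ?case
    using Suc.IH bounded_linear.has_derivative[OF L, of f]
    by (intro Ck_on.simps(2)[THEN iffD2] exI[of _ "\<lambda>x h. L (f' x h)"]) auto
qed

text \<open>One induction covers the matrix product, the cross product and scaling. The product rule
  pairs an undifferentiated factor with the derivative of the other, so that factor is first lowered
  to level \<open>k\<close>.\<close>

lemma Ck_on_bilinear: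
  assumes B: "bounded_bilinear B"
  shows "Ck_on k S f \<Longrightarrow> Ck_on k S g \<Longrightarrow> Ck_on k S (\<lambda>x. B (f x) (g x))"
proof (induction k arbitrary: f g)
  case 0
  then show ?case
    using bounded_bilinear.continuous_on[OF B] by auto
next
  case (Suc k)
  then obtain f' g' where *:
    "\<forall>x\<in>S. (f has_derivative f' x) (at x within S)" "\<forall>h. Ck_on k S (\<lambda>x. f' x h)"
    "\<forall>x\<in>S. (g has_derivative g' x) (at x within S)" "\<forall>h. Ck_on k S (\<lambda>x. g' x h)"
    by auto
  have "\<forall>x\<in>S. ((\<lambda>x. B (f x) (g x)) has_derivative (\<lambda>h. B (f x) (g' x h) + B (f' x h) (g x)))
      (at x within S)"
    using * bounded_bilinear.FDERIV[OF B] by blast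
  moreover have "Ck_on k S (\<lambda>x. B (f x) (g' x h) + B (f' x h) (g x))" for h
    using * Suc by (intro Ck_on_add Suc.IH) (auto dest: Ck_on_Suc_imp simp del: Ck_on.simps)
  ultimately show ?case
    by (auto intro!: exI[of _ "\<lambda>x h. B (f x) (g' x h) + B (f' x h) (g x)"])
qed

text \<open>The pair is the sum of the linear images \<open>(f x, 0)\<close> and
  \<open>(0, g x)\<close>.\<close>

lemma Ck_on_Pair: "Ck_on k S f \<Longrightarrow> Ck_on k S g \<Longrightarrow> Ck_on k S (\<lambda>x. (f x, g x))"
  using Ck_on_add[of k S "\<lambda>x. (f x, 0)" "\<lambda>x. (0, g x)"]
    Ck_on_linear[of "\<lambda>a. (a, 0)" k S f] Ck_on_linear[of "\<lambda>b. (0, b)" k S g]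
  by (simp add: bounded_linear_Pair bounded_linear_ident bounded_linear_zero)

text \<open>Affine inner maps cover the projections, the slices and the exchange of variables used
  below. Their derivative is constant, so a fixed direction \<open>h\<close> becomes the fixed
  direction \<open>L h\<close> and the induction hypothesis applies to \<open>f'\<close> in that
  direction.\<close>

lemma Ck_on_affine:
  assumes L: "bounded_linear L"
  shows "Ck_on k T f \<Longrightarrow> (\<And>x. x \<in> S \<Longrightarrow> c + L x \<in> T) \<Longrightarrow> Ck_on k S (\<lambda>x. f (c + L x))"
proof (induction k arbitrary: f)
  case 0
  have "continuous_on S (\<lambda>x. c + L x)"
    using bounded_linear.continuous_on[OF L continuous_on_id] by (intro continuous_on_add) auto
  with 0 show ?case
    by (auto intro: continuous_on_compose2)
next
  case (Suc k)
  then obtain f' where *: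
    "\<forall>x\<in>T. (f has_derivative f' x) (at x within T)" "\<forall>h. Ck_on k T (\<lambda>x. f' x h)"
    by auto
  have "((\<lambda>x. f (c + L x)) has_derivative (\<lambda>h. f' (c + L x) (L h))) (at x within S)"
    if "x \<in> S" for x
  proof (rule has_derivative_in_compose2[of T f f'])
    show "((\<lambda>x. c + L x) has_derivative L) (at x within S)"
      using bounded_linear_imp_has_derivative[OF L]
      by (auto intro!: derivative_eq_intros)
  qed (use * that Suc.prems in auto)
  moreover have "Ck_on k S (\<lambda>x. f' (c + L x) (L h))" for h
    using Suc.IH[of "\<lambda>y. f' y (L h)"] * Suc.prems by blast
  ultimately show ?case
    by (auto intro!: exI[of _ "\<lambda>x h. f' (c + L x) (L h)"])
qed

section \<open>Closure rules for smooth maps\<close>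

lemma smooth_on_Pair: "smooth_on S f \<Longrightarrow> smooth_on S g \<Longrightarrow> smooth_on S (\<lambda>x. (f x, g x))"
  by (simp add: smooth_on_def Ck_on_Pair)

lemma smooth_on_linear: "bounded_linear L \<Longrightarrow> smooth_on S f \<Longrightarrow> smooth_on S (\<lambda>x. L (f x))"
  by (simp add: smooth_on_def Ck_on_linear)

lemma smooth_on_add: "smooth_on S f \<Longrightarrow> smooth_on S g \<Longrightarrow> smooth_on S (\<lambda>x. f x + g x)"
  by (simp add: smooth_on_def Ck_on_add)

lemma smooth_on_bilinear:
  "bounded_bilinear B \<Longrightarrow> smooth_on S f \<Longrightarrow> smooth_on S g \<Longrightarrow> smooth_on S (\<lambda>x. B (f x) (g x))"
  by (simp add: smooth_on_def Ck_on_bilinear)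

lemma smooth_on_const: "smooth_on S (\<lambda>x. c)"
  by (simp add: smooth_on_def Ck_on_const)

lemma smooth_on_affine:
  assumes "bounded_linear L" "smooth_on T f" "\<And>x. x \<in> S \<Longrightarrow> c + L x \<in> T"
  shows "smooth_on S (\<lambda>x. f (c + L x))"
  using assms Ck_on_affine[of L _ T f S c] by (simp add: smooth_on_def)

text \<open>The derivative of \<open>f\<close> in direction \<open>h\<close> is
  \<open>h *\<^sub>R g x\<close>, as regular as \<open>g\<close>; hence \<open>f\<close> is of every
  class \<open>Suc k\<close>.\<close>

lemma smooth_on_antiderivative:
  assumes "smooth_on S g" "\<And>x. x \<in> S \<Longrightarrow> (f has_vector_derivative g x) (at x within S)"
  shows "smooth_on S f"
  unfolding smooth_on_def
proof
  fix k
  have "Ck_on (Suc k) S f"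
    using assms Ck_on_linear[OF bounded_linear_scaleR_right, of k S g]
    by (auto simp: has_vector_derivative_def smooth_on_def intro!: exI[of _ "\<lambda>x h. h *\<^sub>R g x"])
  then show "Ck_on k S f"
    by (rule Ck_on_Suc_imp)
qed

lemma smooth_on_continuous_on: "smooth_on S f \<Longrightarrow> continuous_on S f"
  by (metis smooth_on_def Ck_on.simps(1))

lemma smooth_on_has_vector_derivative:
  fixes S :: "real set"
  assumes "smooth_on S f" "x \<in> S"
  shows "(f has_vector_derivative vector_derivative f (at x within S)) (at x within S)"
proof -
  have "Ck_on (Suc 0) S f"
    using assms(1) by (simp add: smooth_on_def del: Ck_on.simps)
  then show ?thesis
    using assms(2) by (auto simp: differentiable_def simp flip: vector_derivative_works)
qed

section \<open>Partial derivatives of maps on a product\<close>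

lemma Ck_on_Suc_partial_u:
  assumes "Ck_on (Suc k) (I \<times> J) (\<lambda>(u, v). T u v)"
  obtains D where "Ck_on k (I \<times> J) (\<lambda>(u, v). D u v)"
    and "\<And>u v. u \<in> I \<Longrightarrow> v \<in> J \<Longrightarrow> ((\<lambda>s. T s v) has_vector_derivative D u v) (at u within I)"
proof -
  obtain f' where f':
    "\<forall>x\<in>I \<times> J. ((\<lambda>(u, v). T u v) has_derivative f' x) (at x within I \<times> J)"
    "\<forall>h. Ck_on k (I \<times> J) (\<lambda>x. f' x h)"
    using assms by auto
  \<comment> \<open>The partial derivative is the total one in the fixed direction
    \<open>(1, 0)\<close>, so its regularity is already contained in \<open>Ck_on\<close>. It arises
    by composing with the insertion of \<open>s\<close> into the slice at height
    \<open>v\<close>.\<close>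
  have "((\<lambda>s. T s v) has_vector_derivative f' (u, v) (1, 0)) (at u within I)"
    if "u \<in> I" "v \<in> J" for u v
  proof -
    have "((\<lambda>s. (\<lambda>(u, v). T u v) (s, v)) has_derivative (\<lambda>h. f' (u, v) (h, 0))) (at u within I)"
    proof (rule has_derivative_in_compose2[of "I \<times> J" "\<lambda>(u, v). T u v" f'])
      show "((\<lambda>s. (s, v)) has_derivative (\<lambda>h. (h, 0))) (at u within I)"
        by (intro has_derivative_Pair has_derivative_ident has_derivative_const)
    qed (use that f'(1) in auto)
    moreover have "bounded_linear (f' (u, v))"
      using f'(1) that by (auto intro: has_derivative_bounded_linear)
    then have "(\<lambda>h. f' (u, v) (h, 0)) = (\<lambda>h. h *\<^sub>R f' (u, v) (1, 0))"
      using linear_scale[of "f' (u, v)" _ "(1, 0)"] by (auto dest: bounded_linear.linear)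
    ultimately show ?thesis
      by (simp only: has_vector_derivative_def prod.case)
  qed
  then show ?thesis
    using f'(2) that[of "\<lambda>u v. f' (u, v) (1, 0)"] by (simp add: case_prod_unfold)
qed

lemma Ck_on_swap:
  "Ck_on k (I \<times> J) (\<lambda>(u, v). T u v) \<Longrightarrow> Ck_on k (J \<times> I) (\<lambda>(v, u). T u v)"
  using Ck_on_affine[of "\<lambda>p. (snd p, fst p)" k "I \<times> J" "\<lambda>(u, v). T u v" "J \<times> I" 0]
  by (auto simp: case_prod_unfold bounded_linear_Pair bounded_linear_fst bounded_linear_snd)

lemma Ck_on_Suc_partial_v:
  assumes "Ck_on (Suc k) (I \<times> J) (\<lambda>(u, v). T u v)"
  obtains D where "Ck_on k (I \<times> J) (\<lambda>(u, v). D u v)"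
    and "\<And>u v. u \<in> I \<Longrightarrow> v \<in> J \<Longrightarrow> ((\<lambda>t. T u t) has_vector_derivative D u v) (at v within J)"
proof -
  obtain D where "Ck_on k (J \<times> I) (\<lambda>(v, u). D v u)"
    "\<And>v u. v \<in> J \<Longrightarrow> u \<in> I \<Longrightarrow> ((\<lambda>t. T u t) has_vector_derivative D v u) (at v within J)"
    using Ck_on_Suc_partial_u[OF Ck_on_swap[OF assms]] by blast
  then show ?thesis
    using that[of "\<lambda>u v. D v u"] Ck_on_swap[of k J I D] by blast
qed

section \<open>Intervals\<close>

text \<open>A connected set with more than one point has no isolated points. This makes one-sided
  derivatives at endpoints unique, so that \<open>vector_derivative\<close> can be computed from any
  known derivative.\<close>

lemma nondegenerate_interval_at_within:
  assumes "nondegenerate_interval I" "x \<in> I"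
  shows "at x within I \<noteq> bot"
proof -
  have "I \<noteq> {y}" for y
    using assms by (auto simp: nondegenerate_interval_def)
  then show ?thesis
    using connected_imp_perfect[of I x] assms
    by (auto simp: nondegenerate_interval_def is_interval_connected_1 trivial_limit_within)
qed

text \<open>The integral from a fixed base point \<open>c\<close> works on an interval of any shape:
  near each \<open>x\<close> the fundamental theorem is applied on a compact subinterval that looks
  like \<open>I\<close> around \<open>x\<close>.\<close>

lemma interval_antiderivative:
  fixes g :: "real \<Rightarrow> 'a::euclidean_space"
  assumes I: "is_interval I" "I \<noteq> {}" and g: "continuous_on I g"
  obtains f where "\<And>x. x \<in> I \<Longrightarrow> (f has_vector_derivative g x) (at x within I)"
proof -
  obtain c where c: "c \<in> I"
    using I by auto
  have "((\<lambda>x. LBINT y=c..x. g y) has_vector_derivative g x) (at x within I)" if x: "x \<in> I" for x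
  proof -
    \<comment> \<open>The left end \<open>a\<close> may coincide with \<open>x\<close> only if
      \<open>x\<close> is the least point of \<open>I\<close>; \<open>b\<close> is chosen
      symmetrically. So no part of \<open>I\<close> near \<open>x\<close> is cut off.\<close>
    obtain a where a: "a \<in> I" "a \<le> c" "a \<le> x" "a = x \<Longrightarrow> \<forall>y\<in>I. x \<le> y"
    proof (cases "\<exists>y\<in>I. y < x")
      case True
      then obtain y where "y \<in> I" "y < x" by auto
      then show ?thesis
        using that[of y] that[of c] c x by (cases "y \<le> c") auto
    next
      case False
      then show ?thesis
        using that[of x] c x by (auto simp: not_less)
    qed
    obtain b where b: "b \<in> I" "c \<le> b" "x \<le> b" "b = x \<Longrightarrow> \<forall>y\<in>I. y \<le> x"
    proof (cases "\<exists>y\<in>I. y > x")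
      case True
      then obtain y where "y \<in> I" "y > x" by auto
      then show ?thesis
        using that[of y] that[of c] c x by (cases "y \<ge> c") auto
    next
      case False
      then show ?thesis
        using that[of x] c x by (auto simp: not_less)
    qed
    have sub: "{a..b} \<subseteq> I"
      using I(1) a(1) b(1) by (meson atLeastAtMost_iff is_interval_1 subsetI)
    \<comment> \<open>An open neighbourhood of \<open>x\<close> on which \<open>{a..b}\<close> and
      \<open>I\<close> agree. A bound is imposed only on a side where \<open>x\<close> is not an end
      of \<open>{a..b}\<close>.\<close>
    define S where "S = (if a < x then {a<..} else UNIV) \<inter> (if x < b then {..<b} else UNIV)"
    have "x \<in> S" "open S"
      by (auto simp: S_def)
    moreover have "y \<in> {a..b}" if "y \<in> I" "y \<in> S" for y
    proof -
      have "a \<le> y"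
        using that a(3,4) by (cases "a = x") (auto simp: S_def)
      moreover have "y \<le> b"
        using that b(3,4) by (cases "b = x") (auto simp: S_def)
      ultimately show ?thesis
        by simp
    qed
    then have "{a..b} \<inter> S - {x} = I \<inter> S - {x}"
      using sub by blast
    ultimately have "at x within {a..b} = at x within I"
      by (rule at_within_nhd)
    then show ?thesis
      using interval_integral_FTC2[of a c b g x] a b continuous_on_subset[OF g sub] by simp
  qed
  then show ?thesis
    by (rule that)
qed

section \<open>Matrices and frames\<close>

lemma bounded_bilinear_matrix_mult: "bounded_bilinear ((**) :: real^'n^'m \<Rightarrow> real^'p^'n \<Rightarrow> real^'p^'m)"
  unfolding bilinear_conv_bounded_bilinear[symmetric] bilinear_def
  by (auto intro!: linearI simp: vec_eq_iff matrix_matrix_mult_def sum.distrib sum_distrib_left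
      algebra_simps)

lemma bounded_linear_transpose: "bounded_linear (transpose :: real^'n^'m \<Rightarrow> real^'m^'n)"
  unfolding linear_conv_bounded_linear[symmetric]
  by (auto intro!: linearI simp: vec_eq_iff transpose_def)

text \<open>With rows as entries, \<open>axis i\<close> is the linear embedding of a vector as the
  \<open>i\<close>-th row of a matrix that is zero elsewhere.\<close>

lemma bounded_linear_axis: "bounded_linear (axis i :: 'a::euclidean_space \<Rightarrow> 'a^'n)"
  unfolding linear_conv_bounded_linear[symmetric]
  by (auto intro!: linearI simp: vec_eq_iff axis_def)

lemma bounded_bilinear_cross3: "bounded_bilinear cross3"
  using bilinear_cross bilinear_conv_bounded_bilinear by blast

lemmas matrix_mult_linear_simps =
  bounded_bilinear.add_left[OF bounded_bilinear_matrix_mult]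
  bounded_bilinear.add_right[OF bounded_bilinear_matrix_mult]
  bounded_bilinear.minus_left[OF bounded_bilinear_matrix_mult]
  bounded_bilinear.minus_right[OF bounded_bilinear_matrix_mult]

lemma has_vector_derivative_matrix_mult:
  fixes f :: "real \<Rightarrow> real^'n^'m" and g :: "real \<Rightarrow> real^'p^'n"
  assumes "(f has_vector_derivative f') (at x within S)" "(g has_vector_derivative g') (at x within S)"
  shows "((\<lambda>x. f x ** g x) has_vector_derivative (f x ** g' + f' ** g x)) (at x within S)"
  using bounded_bilinear.has_vector_derivative[OF bounded_bilinear_matrix_mult assms] .

lemma has_vector_derivative_transpose:
  fixes f :: "real \<Rightarrow> real^'n^'m"
  assumes "(f has_vector_derivative f') (at x within S)"
  shows "((\<lambda>x. transpose (f x)) has_vector_derivative transpose f') (at x within S)"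
  using bounded_linear.has_vector_derivative[OF bounded_linear_transpose assms] .

section \<open>Rotation matrices and oriented orthonormal frames\<close>

lemma rotation_matrix_mult: "rotation_matrix A \<Longrightarrow> rotation_matrix B \<Longrightarrow> rotation_matrix (A ** B)"
  for A B :: "real^'n^'n"
  by (simp add: rotation_matrix_def orthogonal_matrix_mul det_mul)

lemma rotation_matrix_transpose: "rotation_matrix A \<Longrightarrow> rotation_matrix (transpose A)"
  for A :: "real^'n^'n"
  by (simp add: rotation_matrix_def)

lemma rotation_matrix_inverse:
  fixes A :: "real^'n^'n"
  assumes "rotation_matrix A"
  shows "transpose A ** A = mat 1" "A ** transpose A = mat 1"
  using assms by (auto simp: rotation_matrix_def orthogonal_matrix_def)

text \<open>The determinant is the triple product of a, b and their cross product, that is, the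
  squared norm of the cross product. Lagrange's identity makes it 1.\<close>

lemma rotation_matrix_frame:
  assumes "(a, b) \<in> Delta"
  shows "rotation_matrix (frame a b)"
proof -
  have "det (frame a b) = cross3 a b \<bullet> cross3 a b"
    by (simp add: frame_def dot_cross_det[symmetric]) (simp add: cross3_simps)
  also have "\<dots> = 1"
    using norm_cross_dot[of a b] assms by (simp add: Delta_def flip: power2_norm_eq_inner)
  finally show ?thesis
    using orthogonal_matrix_frame[OF assms] by (simp add: rotation_matrix_def)
qed

text \<open>Conversely to the previous lemma, the first two rows determine a rotation: the rows are
  orthonormal, and rotations preserve cross products, which forces the third row.\<close>

lemma rotation_matrix_rows:
  fixes A :: "real^3^3"
  assumes "rotation_matrix A"
  shows "(A $ 1, A $ 2) \<in> Delta" "frame (A $ 1) (A $ 2) = A"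
proof -
  have "(A ** transpose A) $ i $ j = A $ i \<bullet> A $ j" for i j
    by (simp add: matrix_matrix_mult_def transpose_def inner_vec_def)
  then have "A $ i \<bullet> A $ j = (if i = j then 1 else 0)" for i j
    using rotation_matrix_inverse(2)[OF assms] by (simp add: mat_def)
  then show "(A $ 1, A $ 2) \<in> Delta"
    by (simp add: Delta_def norm_eq_1)
  \<comment> \<open>The rows are the images of the standard basis under the transposed rotation, so
    the relation between \<open>axis 1 1\<close>, \<open>axis 2 1\<close> and
    \<open>axis 3 1\<close> carries over to them.\<close>
  have row: "A $ i = transpose A *v axis i 1" for i
    by (simp add: column_def transpose_def vec_eq_iff matrix_vector_mult_basis)
  have "cross3 (A $ 1) (A $ 2) = transpose A *v cross3 (axis 1 1) (axis 2 1)"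
    unfolding row by (rule cross_rotation_matrix[OF rotation_matrix_transpose[OF assms]])
  also have "cross3 (axis 1 1) (axis 2 1) = (axis 3 1 :: real^3)"
    by (simp add: cross3_def axis_def vec_eq_iff forall_3)
  finally show "frame (A $ 1) (A $ 2) = A"
    by (simp add: frame_def vec_eq_iff[of _ A] forall_3 row)
qed

section \<open>Frames along curves\<close>

lemma frame_matrix_eq:
  "frame_matrix \<nu>1 \<nu>2 \<nu>1' \<nu>2' u v = frame (\<nu>1' v) (\<nu>2' v) ** transpose (frame (\<nu>1 u) (\<nu>2 u))"
  by (simp add: frame_matrix_def matrix_matrix_mult_def transpose_def inner_vec_def)

lemma smooth_on_frame:
  assumes "smooth_on S a" "smooth_on S b"
  shows "smooth_on S (\<lambda>x. frame (a x) (b x))"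
proof -
  have "frame x y = axis 1 x + (axis 2 y + axis 3 (cross3 x y))" for x y
    by (simp add: frame_def vec_eq_iff forall_3 axis_def)
  then show ?thesis
    using assms
    by (auto intro!: smooth_on_add smooth_on_linear[OF bounded_linear_axis]
        smooth_on_bilinear[OF bounded_bilinear_cross3])
qed

lemma framed_curve_smooth_frame:
  assumes "framed_curve I \<gamma> \<nu>1 \<nu>2"
  shows "smooth_on I (\<lambda>u. frame (\<nu>1 u) (\<nu>2 u))"
proof -
  have *: "smooth_on I (\<lambda>u. (\<gamma> u, \<nu>1 u, \<nu>2 u))"
    using assms by (simp add: framed_curve_def)
  have "smooth_on I (\<lambda>u. fst (snd (\<gamma> u, \<nu>1 u, \<nu>2 u)))" "smooth_on I (\<lambda>u. snd (snd (\<gamma> u, \<nu>1 u, \<nu>2 u)))"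
    by (intro smooth_on_linear[OF _ *] bounded_linear_fst_comp bounded_linear_snd_comp bounded_linear_snd)+
  then show ?thesis
    by (simp add: smooth_on_frame)
qed

text \<open>The curve is an antiderivative of the prescribed multiple of the third frame vector.
  That vector is orthogonal to the first two rows, which gives the tangency conditions.\<close>

lemma framed_curve_from_frame:
  assumes I: "nondegenerate_interval I" and F: "smooth_on I F" "\<And>u. u \<in> I \<Longrightarrow> rotation_matrix (F u)"
    and \<alpha>: "smooth_on I \<alpha>"
  obtains \<gamma> where "framed_curve I \<gamma> (\<lambda>u. F u $ 1) (\<lambda>u. F u $ 2)"
    and "\<And>u. u \<in> I \<Longrightarrow>
      vector_derivative \<gamma> (at u within I) = \<alpha> u *\<^sub>R cross3 (F u $ 1) (F u $ 2)"
proof -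
  have row: "smooth_on I (\<lambda>u. F u $ i)" for i
    using smooth_on_linear[OF bounded_linear_vec_nth F(1)] .
  let ?g = "\<lambda>u. \<alpha> u *\<^sub>R cross3 (F u $ 1) (F u $ 2)"
  have g: "smooth_on I ?g"
    by (intro smooth_on_bilinear[OF bounded_bilinear_scaleR] \<alpha> row
        smooth_on_bilinear[OF bounded_bilinear_cross3])
  have "is_interval I" "I \<noteq> {}"
    using I by (auto simp: nondegenerate_interval_def)
  then obtain \<gamma> where \<gamma>: "\<And>u. u \<in> I \<Longrightarrow> (\<gamma> has_vector_derivative ?g u) (at u within I)"
    using interval_antiderivative[OF _ _ smooth_on_continuous_on[OF g]] by blast
  have D: "vector_derivative \<gamma> (at u within I) = ?g u" if "u \<in> I" for u
    using vector_derivative_within[OF nondegenerate_interval_at_within[OF I that] \<gamma>[OF that]] .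
  have "framed_curve I \<gamma> (\<lambda>u. F u $ 1) (\<lambda>u. F u $ 2)"
    unfolding framed_curve_def
    using smooth_on_Pair[OF smooth_on_antiderivative[OF g \<gamma>] smooth_on_Pair[OF row row]]
    by (auto simp: D rotation_matrix_rows F dot_cross_self)
  then show ?thesis
    using D that by blast
qed

section \<open>The frame equation\<close>

lemma frame_product_equation:
  fixes F G :: "real \<Rightarrow> real^'n^'n"
  assumes I: "nondegenerate_interval I" and J: "nondegenerate_interval J"
    and F: "smooth_on I F" "\<And>u. u \<in> I \<Longrightarrow> rotation_matrix (F u)"
    and G: "smooth_on J G" "\<And>v. v \<in> J \<Longrightarrow> rotation_matrix (G v)"
    and T: "\<And>u v. T u v = G v ** transpose (F u)"
    and uv: "u \<in> I" "v \<in> J"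
  shows "partial_v J (partial_u I T) u v = partial_v J T u v ** transpose (T u v) ** partial_u I T u v"
proof -
  obtain F' where F': "(F has_vector_derivative F') (at u within I)"
    using smooth_on_has_vector_derivative[OF F(1) uv(1)] by blast
  obtain G' where G': "(G has_vector_derivative G') (at v within J)"
    using smooth_on_has_vector_derivative[OF G(1) uv(2)] by blast
  have const: "((\<lambda>x. c) has_vector_derivative 0) (at x within S)" for c :: "real^'n^'n" and x S
    by (rule has_vector_derivative_const)
  \<comment> \<open>Stated for every \<open>t\<close>, since the outer derivative in v
    differentiates this expression as a function of \<open>t\<close>.\<close>
  have Tu: "partial_u I T u t = G t ** transpose F'" for t
    unfolding partial_u_def T
    using has_vector_derivative_matrix_mult[OF const has_vector_derivative_transpose[OF F'], of "G t"]
    by (intro vector_derivative_within nondegenerate_interval_at_within I uv) (simp add: bounded_bilinear.zero_left[OF bounded_bilinear_matrix_mult] bounded_bilinear.zero_right[OF bounded_bilinear_matrix_mult])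
  have Tv: "partial_v J T u v = G' ** transpose (F u)"
    unfolding partial_v_def T
    using has_vector_derivative_matrix_mult[OF G' const, of "transpose (F u)"]
    by (intro vector_derivative_within nondegenerate_interval_at_within J uv) (simp add: bounded_bilinear.zero_left[OF bounded_bilinear_matrix_mult] bounded_bilinear.zero_right[OF bounded_bilinear_matrix_mult])
  have Tuv: "partial_v J (partial_u I T) u v = G' ** transpose F'"
    unfolding partial_v_def Tu
    using has_vector_derivative_matrix_mult[OF G' const, of "transpose F'"]
    by (intro vector_derivative_within nondegenerate_interval_at_within J uv) (simp add: bounded_bilinear.zero_left[OF bounded_bilinear_matrix_mult] bounded_bilinear.zero_right[OF bounded_bilinear_matrix_mult])
  \<comment> \<open>The transpose of \<open>T\<close> is \<open>F G^t\<close>, so the inner factors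
    group into \<open>F^t F\<close> and \<open>G^t G\<close>, both the identity; what remains is the
    mixed derivative.\<close>
  have "G' ** transpose (F u) ** transpose (T u v) ** (G v ** transpose F')
      = G' ** (transpose (F u) ** F u) ** (transpose (G v) ** G v) ** transpose F'"
    by (simp add: T matrix_transpose_mul matrix_mul_assoc)
  then show ?thesis
    by (simp add: Tu Tv Tuv rotation_matrix_inverse F G uv)
qed

text \<open>Differentiate \<open>F^t F = 1\<close>: the left side obeys the product rule, and the
  right side is constant on \<open>I\<close>.\<close>

lemma rotation_field_derivative_skew:
  fixes F :: "real \<Rightarrow> real^'n^'n"
  assumes I: "nondegenerate_interval I" "u \<in> I"
    and F: "\<And>u. u \<in> I \<Longrightarrow> rotation_matrix (F u)" "(F has_vector_derivative F') (at u within I)"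
  shows "transpose F' ** F u = - (transpose (F u) ** F')"
proof -
  have "((\<lambda>u. transpose (F u) ** F u) has_vector_derivative transpose (F u) ** F' + transpose F' ** F u)
      (at u within I)"
    by (intro has_vector_derivative_matrix_mult has_vector_derivative_transpose F)
  moreover have "((\<lambda>u. transpose (F u) ** F u) has_vector_derivative 0) (at u within I)"
    by (rule has_vector_derivative_transform[OF _ _ has_vector_derivative_const[of "mat 1"]])
      (use I F in \<open>auto simp: rotation_matrix_inverse\<close>)
  ultimately have "transpose (F u) ** F' + transpose F' ** F u = 0"
    using vector_derivative_unique_within[OF nondegenerate_interval_at_within[OF I]] by blast
  then show ?thesis
    by (simp add: eq_neg_iff_add_eq_0 add.commute)
qed

text \<open>For fixed \<open>v\<close> and \<open>v0\<close>, both \<open>T u v\<close> and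
  \<open>T u v0\<close> solve one linear equation \<open>X' = X W\<close> in u, with a skew
  \<open>W\<close> that depends only on u. For two such solutions the derivative of
  \<open>X Y^t\<close> is \<open>X (W + W^t) Y^t = 0\<close>.\<close>

lemma frame_equation_factorization:
  fixes T :: "real \<Rightarrow> real \<Rightarrow> real^'n^'n"
  assumes I: "nondegenerate_interval I" and J: "nondegenerate_interval J"
    and T: "smooth_on (I \<times> J) (\<lambda>(u, v). T u v)"
    and rot: "\<And>u v. u \<in> I \<Longrightarrow> v \<in> J \<Longrightarrow> rotation_matrix (T u v)"
    and eq: "\<And>u v. u \<in> I \<Longrightarrow> v \<in> J \<Longrightarrow>
      partial_v J (partial_u I T) u v = partial_v J T u v ** transpose (T u v) ** partial_u I T u v"
    and mem: "u0 \<in> I" "v0 \<in> J" "u \<in> I" "v \<in> J"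
  shows "T u v ** transpose (T u v0) = T u0 v ** transpose (T u0 v0)"
proof -
  have conv: "convex I" "convex J"
    using I J by (auto simp: nondegenerate_interval_def is_interval_convex)
  \<comment> \<open>Two orders of differentiability give \<open>P\<close> for the u-derivative and
    \<open>R\<close> for the v-derivative of \<open>P\<close>, in the same order as in the equation;
    \<open>Q\<close> is the v-derivative of \<open>T\<close>.\<close>
  have "Ck_on (Suc (Suc 0)) (I \<times> J) (\<lambda>(u, v). T u v)"
    using T by (simp add: smooth_on_def del: Ck_on.simps)
  then obtain P where C1: "Ck_on (Suc 0) (I \<times> J) (\<lambda>(u, v). P u v)"
    and P: "\<And>u v. u \<in> I \<Longrightarrow> v \<in> J \<Longrightarrow> ((\<lambda>s. T s v) has_vector_derivative P u v) (at u within I)"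
    using Ck_on_Suc_partial_u by blast
  obtain R where "Ck_on 0 (I \<times> J) (\<lambda>(u, v). R u v)"
    and R: "\<And>u v. u \<in> I \<Longrightarrow> v \<in> J \<Longrightarrow> ((\<lambda>t. P u t) has_vector_derivative R u v) (at v within J)"
    by (rule Ck_on_Suc_partial_v[OF C1]) (rule that; blast)
  have "Ck_on (Suc 0) (I \<times> J) (\<lambda>(u, v). T u v)"
    using T by (simp add: smooth_on_def del: Ck_on.simps)
  then obtain Q where "Ck_on 0 (I \<times> J) (\<lambda>(u, v). Q u v)"
    and Q: "\<And>u v. u \<in> I \<Longrightarrow> v \<in> J \<Longrightarrow> ((\<lambda>t. T u t) has_vector_derivative Q u v) (at v within J)"
    by (rule Ck_on_Suc_partial_v) (rule that; blast)
  have Tu: "partial_u I T u v = P u v" if "u \<in> I" "v \<in> J" for u v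
    unfolding partial_u_def
    by (intro vector_derivative_within nondegenerate_interval_at_within I P that)
  have Tv: "partial_v J T u v = Q u v" if "u \<in> I" "v \<in> J" for u v
    unfolding partial_v_def
    by (intro vector_derivative_within nondegenerate_interval_at_within J Q that)
  have "partial_v J (partial_u I T) u v = R u v" if "u \<in> I" "v \<in> J" for u v
    unfolding partial_v_def
    by (intro vector_derivative_within nondegenerate_interval_at_within J that
        has_vector_derivative_transform[OF _ _ R[OF that]] Tu)
  then have R_eq: "R u v = Q u v ** transpose (T u v) ** P u v" if "u \<in> I" "v \<in> J" for u v
    using eq[OF that] that by (simp add: Tu Tv)
  have \<Omega>: "transpose (T u v) ** P u v = transpose (T u v0) ** P u v0"
    if u: "u \<in> I" and v: "v \<in> J" for u v
  proof -
    have "((\<lambda>t. transpose (T u t) ** P u t) has_vector_derivative 0) (at t within J)"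
      if t: "t \<in> J" for t
    proof -
      \<comment> \<open>Inserting \<open>T T^t = 1\<close> exposes the factor \<open>Q^t T\<close>,
        which skewness in the v-direction turns into \<open>- T^t Q\<close>. The result is the
        negative of \<open>T^t R\<close> by the frame equation.\<close>
      have "transpose (Q u t) ** P u t = transpose (Q u t) ** (T u t ** transpose (T u t)) ** P u t"
        by (simp add: rotation_matrix_inverse rot u t)
      also have "\<dots> = - (transpose (T u t) ** Q u t) ** transpose (T u t) ** P u t"
        using rotation_field_derivative_skew[OF J t rot[OF u] Q[OF u t]]
        by (simp add: matrix_mul_assoc)
      finally have "transpose (T u t) ** R u t + transpose (Q u t) ** P u t = 0"
        by (simp add: R_eq u t matrix_mul_assoc matrix_mult_linear_simps)
      then show ?thesis
        using has_vector_derivative_matrix_mult[OF has_vector_derivative_transpose[OF Q[OF u t]] R[OF u t]]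
        by simp
    qed
    then obtain C where "\<And>t. t \<in> J \<Longrightarrow> transpose (T u t) ** P u t = C"
      using has_vector_derivative_zero_constant[OF conv(2), of "\<lambda>t. transpose (T u t) ** P u t"]
      by blast
    with v mem(2) show ?thesis
      by simp
  qed
  have "((\<lambda>s. T s v ** transpose (T s v0)) has_vector_derivative 0) (at s within I)"
    if s: "s \<in> I" for s
  proof -
    let ?W = "transpose (T s v0) ** P s v0"
    have skew: "transpose ?W = - ?W"
      using rotation_field_derivative_skew[OF I s rot[OF _ mem(2)] P[OF s mem(2)]]
      by (simp add: matrix_transpose_mul)
    \<comment> \<open>Since \<open>T^t P\<close> does not depend on the second variable, its value
      at \<open>v0\<close> serves as coefficient for every \<open>w\<close>.\<close>
    have P_eq: "P s w = T s w ** ?W" if "w \<in> J" for w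
    proof -
      have "P s w = (T s w ** transpose (T s w)) ** P s w"
        by (simp add: rotation_matrix_inverse rot s that)
      then show ?thesis
        using \<Omega>[OF s that] by (metis matrix_mul_assoc)
    qed
    have "T s v ** transpose (P s v0) = T s v ** (transpose ?W ** transpose (T s v0))"
      by (subst P_eq[OF mem(2)]) (simp only: matrix_transpose_mul)
    also have "\<dots> = - (P s v ** transpose (T s v0))"
      unfolding skew P_eq[OF mem(4)] by (simp add: matrix_mul_assoc matrix_mult_linear_simps)
    finally show ?thesis
      using has_vector_derivative_matrix_mult[OF P[OF s mem(4)] has_vector_derivative_transpose[OF P[OF s mem(2)]]]
      by simp
  qed
  then obtain C where "\<And>s. s \<in> I \<Longrightarrow> T s v ** transpose (T s v0) = C"
    using has_vector_derivative_zero_constant[OF conv(1), of "\<lambda>s. T s v ** transpose (T s v0)"]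
    by blast
  with mem show ?thesis
    by simp
qed

theorem theorem2p3:
  fixes I J :: "real set"
  assumes "nondegenerate_interval I" and "nondegenerate_interval J"
  shows
    "(\<forall>\<gamma> \<nu>1 \<nu>2 \<gamma>' \<nu>1' \<nu>2' T.
        framed_curve I \<gamma> \<nu>1 \<nu>2 \<longrightarrow> framed_curve J \<gamma>' \<nu>1' \<nu>2' \<longrightarrow>
        T = frame_matrix \<nu>1 \<nu>2 \<nu>1' \<nu>2' \<longrightarrow>
          smooth_on (I \<times> J) (\<lambda>(u, v). T u v) \<and>
          (\<forall>u\<in>I. \<forall>v\<in>J. rotation_matrix (T u v)) \<and>
          (\<forall>u\<in>I. \<forall>v\<in>J. partial_v J (partial_u I T) u v
             = partial_v J T u v ** transpose (T u v) ** partial_u I T u v)) \<and>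
     (\<forall>(T :: real \<Rightarrow> real \<Rightarrow> real^3^3) (\<alpha> :: real \<Rightarrow> real) (\<alpha>' :: real \<Rightarrow> real).
        smooth_on (I \<times> J) (\<lambda>(u, v). T u v) \<longrightarrow>
        (\<forall>u\<in>I. \<forall>v\<in>J. rotation_matrix (T u v)) \<longrightarrow>
        (\<forall>u\<in>I. \<forall>v\<in>J. partial_v J (partial_u I T) u v
           = partial_v J T u v ** transpose (T u v) ** partial_u I T u v) \<longrightarrow>
        smooth_on I \<alpha> \<longrightarrow> smooth_on J \<alpha>' \<longrightarrow>
        (\<exists>\<gamma> \<nu>1 \<nu>2 \<gamma>' \<nu>1' \<nu>2'.
           framed_curve I \<gamma> \<nu>1 \<nu>2 \<and> framed_curve J \<gamma>' \<nu>1' \<nu>2' \<and>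
           (\<forall>u\<in>I. vector_derivative \<gamma> (at u within I) = \<alpha> u *\<^sub>R cross3 (\<nu>1 u) (\<nu>2 u)) \<and>
           (\<forall>v\<in>J. vector_derivative \<gamma>' (at v within J) = \<alpha>' v *\<^sub>R cross3 (\<nu>1' v) (\<nu>2' v)) \<and>
           (\<forall>u\<in>I. \<forall>v\<in>J. frame_matrix \<nu>1 \<nu>2 \<nu>1' \<nu>2' u v = T u v)))"
proof (intro conjI allI impI)
  fix \<gamma> \<nu>1 \<nu>2 \<gamma>' \<nu>1' \<nu>2' T
  assume F: "framed_curve I \<gamma> \<nu>1 \<nu>2" and G: "framed_curve J \<gamma>' \<nu>1' \<nu>2'"
    and T: "T = frame_matrix \<nu>1 \<nu>2 \<nu>1' \<nu>2'"
  let ?F = "\<lambda>u. frame (\<nu>1 u) (\<nu>2 u)" and ?G = "\<lambda>v. frame (\<nu>1' v) (\<nu>2' v)"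
  have T_eq: "T u v = ?G v ** transpose (?F u)" for u v
    by (simp add: T frame_matrix_eq)
  have sF: "smooth_on I ?F" and sG: "smooth_on J ?G"
    using F G by (auto intro: framed_curve_smooth_frame)
  have rF: "rotation_matrix (?F u)" if "u \<in> I" for u
    using F that by (simp add: framed_curve_def rotation_matrix_frame)
  have rG: "rotation_matrix (?G v)" if "v \<in> J" for v
    using G that by (simp add: framed_curve_def rotation_matrix_frame)
  \<comment> \<open>The summand 0 gives the projections the affine form \<open>c + L x\<close>; the
    slices in the converse are written as affine maps for the same reason.\<close>
  have "smooth_on (I \<times> J) (\<lambda>p. ?F (0 + fst p))" "smooth_on (I \<times> J) (\<lambda>p. ?G (0 + snd p))"
    by (rule smooth_on_affine[OF bounded_linear_fst sF], force)
      (rule smooth_on_affine[OF bounded_linear_snd sG], force)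
  then show "smooth_on (I \<times> J) (\<lambda>(u, v). T u v)"
    unfolding T_eq case_prod_unfold
    by (intro smooth_on_bilinear[OF bounded_bilinear_matrix_mult]
        smooth_on_linear[OF bounded_linear_transpose]) simp_all
  show "\<forall>u\<in>I. \<forall>v\<in>J. rotation_matrix (T u v)"
    unfolding T_eq by (simp add: rF rG rotation_matrix_mult rotation_matrix_transpose)
  show "\<forall>u\<in>I. \<forall>v\<in>J. partial_v J (partial_u I T) u v
      = partial_v J T u v ** transpose (T u v) ** partial_u I T u v"
    using frame_product_equation[OF assms sF rF sG rG T_eq] by blast
next
  fix T :: "real \<Rightarrow> real \<Rightarrow> real^3^3" and \<alpha> \<alpha>' :: "real \<Rightarrow> real"
  assume T: "smooth_on (I \<times> J) (\<lambda>(u, v). T u v)"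
    and rot: "\<forall>u\<in>I. \<forall>v\<in>J. rotation_matrix (T u v)"
    and eq: "\<forall>u\<in>I. \<forall>v\<in>J. partial_v J (partial_u I T) u v
      = partial_v J T u v ** transpose (T u v) ** partial_u I T u v"
    and \<alpha>: "smooth_on I \<alpha>" and \<alpha>': "smooth_on J \<alpha>'"
  obtain u0 v0 where 0: "u0 \<in> I" "v0 \<in> J"
    using assms interior_subset by (fastforce simp: nondegenerate_interval_def)
  \<comment> \<open>The normalization makes \<open>G v0\<close> the identity: the second frame
    starts as the standard basis, and the first frame is then read off from \<open>T\<close> along
    the slice at \<open>v0\<close>.\<close>
  define F where "F u = transpose (T u v0)" for u
  define G where "G v = T u0 v ** transpose (T u0 v0)" for v
  have rF: "rotation_matrix (F u)" if "u \<in> I" for u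
    using rot 0 that by (simp add: F_def rotation_matrix_transpose)
  have rG: "rotation_matrix (G v)" if "v \<in> J" for v
    using rot 0 that by (simp add: G_def rotation_matrix_mult rotation_matrix_transpose)
  have "smooth_on I (\<lambda>u. (\<lambda>(u, v). T u v) ((0, v0) + (u, 0)))"
    by (rule smooth_on_affine[OF _ T])
      (auto simp: 0 bounded_linear_Pair bounded_linear_ident bounded_linear_zero)
  then have sF: "smooth_on I F"
    unfolding F_def by (intro smooth_on_linear[OF bounded_linear_transpose]) simp
  have "smooth_on J (\<lambda>v. (\<lambda>(u, v). T u v) ((u0, 0) + (0, v)))"
    by (rule smooth_on_affine[OF _ T])
      (auto simp: 0 bounded_linear_Pair bounded_linear_ident bounded_linear_zero)
  then have sG: "smooth_on J G"
    unfolding G_def by (intro smooth_on_bilinear[OF bounded_bilinear_matrix_mult] smooth_on_const) simp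
  obtain \<gamma> where \<gamma>: "framed_curve I \<gamma> (\<lambda>u. F u $ 1) (\<lambda>u. F u $ 2)"
    "\<And>u. u \<in> I \<Longrightarrow> vector_derivative \<gamma> (at u within I) = \<alpha> u *\<^sub>R cross3 (F u $ 1) (F u $ 2)"
    using framed_curve_from_frame[OF assms(1) sF rF \<alpha>] by blast
  obtain \<gamma>' where \<gamma>': "framed_curve J \<gamma>' (\<lambda>v. G v $ 1) (\<lambda>v. G v $ 2)"
    "\<And>v. v \<in> J \<Longrightarrow> vector_derivative \<gamma>' (at v within J) = \<alpha>' v *\<^sub>R cross3 (G v $ 1) (G v $ 2)"
    using framed_curve_from_frame[OF assms(2) sG rG \<alpha>'] by blast
  have "frame_matrix (\<lambda>u. F u $ 1) (\<lambda>u. F u $ 2) (\<lambda>v. G v $ 1) (\<lambda>v. G v $ 2) u v = T u v"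
    if "u \<in> I" "v \<in> J" for u v
  proof -
    \<comment> \<open>The factorization moves the first argument from \<open>u\<close> to
      \<open>u0\<close>, where the product is \<open>G v\<close> by definition. Multiplying by
      \<open>T u v0\<close>, the transpose of \<open>F u\<close>, recovers
      \<open>T u v\<close>.\<close>
    have "T u v ** transpose (T u v0) = G v"
      unfolding G_def
      using frame_equation_factorization[OF assms T _ _ 0 that] rot eq by blast
    then have "G v ** T u v0 = T u v ** (transpose (T u v0) ** T u v0)"
      by (simp add: matrix_mul_assoc)
    also have "\<dots> = T u v"
      using rot 0 that by (simp add: rotation_matrix_inverse)
    finally show ?thesis
      by (simp add: frame_matrix_eq rotation_matrix_rows rF rG that) (simp add: F_def)
  qed
  with \<gamma> \<gamma>' show "\<exists>\<gamma> \<nu>1 \<nu>2 \<gamma>' \<nu>1' \<nu>2'.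
      framed_curve I \<gamma> \<nu>1 \<nu>2 \<and> framed_curve J \<gamma>' \<nu>1' \<nu>2' \<and>
      (\<forall>u\<in>I. vector_derivative \<gamma> (at u within I) = \<alpha> u *\<^sub>R cross3 (\<nu>1 u) (\<nu>2 u)) \<and>
      (\<forall>v\<in>J. vector_derivative \<gamma>' (at v within J) = \<alpha>' v *\<^sub>R cross3 (\<nu>1' v) (\<nu>2' v)) \<and>
      (\<forall>u\<in>I. \<forall>v\<in>J. frame_matrix \<nu>1 \<nu>2 \<nu>1' \<nu>2' u v = T u v)"
    by blast
qed

end
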